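(* Let $\Sigma_3=\{0,1,2\}$. Every infinite squarefree word $w$ over $\Sigma_3$ contains at least one occurrence of each of the words $012$, $021$, $102$, $120$, $201$, $210$ (as subwords, i.e. factors of consecutive letters).
   Context: An infinite word over an alphabet $\Sigma$ is a right-infinite sequence $w=w_1w_2w_3\cdots$ of letters of $\Sigma$. A word $u$ is a subword (factor) of $w$ if $u$ occurs as a block of consecutive letters of $w$. A square is a word of the form $xx$ with $x$ a nonempty word; a (finite or infinite) word is squarefree if none of its subwords is a square. *)

theory Defs
  imports "HOL-Library.Omega_Words_Fun"
begin

definition factor :: "'a list \<Rightarrow> 'a word \<Rightarrow> bool"
  where "factor u w \<longleftrightarrow> (\<exists>i j. u = subsequence w i j)"

definition is_square :: "'a list \<Rightarrow> bool"
  where "is_square u \<longleftrightarrow> (\<exists>x. x \<noteq> [] \<and> u = x @ x)"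

definition squarefree_word :: "'a word \<Rightarrow> bool"
  where "squarefree_word w \<longleftrightarrow> \<not> (\<exists>u. factor u w \<and> is_square u)"

end

theory Submission
  imports Defs
begin

text \<open>
  Appending letters one at a time to the empty word, backtracking whenever a suffix is a square or
  equals a fixed word of three distinct letters, dies out: the longest word reached has length 29.
\<close>

text \<open>Words are stored reversed, so that extending to the right is \<open>Cons\<close>
  and suffixes become prefixes.\<close>

definition admissible :: "'a list \<Rightarrow> 'a list \<Rightarrow> bool"
  where "admissible u r \<longleftrightarrow> take (length u) r \<noteq> rev u \<and>
    list_all (\<lambda>k. take k r \<noteq> take k (drop k r)) [1..<Suc (length r div 2)]"

text \<open>Depth \<open>n\<close> tests \<open>n\<close> successive words along a branch and
  accepts the next one untested.\<close>

primrec extendable :: "'a list \<Rightarrow> 'a list \<Rightarrow> nat \<Rightarrow> 'a list \<Rightarrow> bool"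
  where
    "extendable A u 0 r \<longleftrightarrow> True"
  | "extendable A u (Suc n) r \<longleftrightarrow> admissible u r \<and> list_ex (\<lambda>x. extendable A u n (x # r)) A"

text \<open>Every suffix of a prefix of \<open>w\<close> is a factor of \<open>w\<close>, so a
  failed test would exhibit \<open>u\<close> or a square in \<open>w\<close>.\<close>

lemma admissible_prefix:
  assumes "squarefree_word w" and "\<not> factor u w"
  shows "admissible u (rev (prefix i w))"
proof -
  let ?p = "prefix i w"
  have drop: "factor (drop j ?p) w" for j
    unfolding factor_def by (metis subsequence_drop)
  have "take (length u) (rev ?p) \<noteq> rev u"
    using drop assms(2) by (metis rev_rev_ident take_rev)
  moreover have "take k (rev ?p) \<noteq> take k (drop k (rev ?p))"
    if "1 \<le> k" "k \<le> length (rev ?p) div 2" for k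
  proof
    let ?x = "take k (rev ?p)"
    assume eq: "?x = take k (drop k (rev ?p))"
    \<comment> \<open>Reversing back turns two equal leading blocks into a square ending the
      prefix.\<close>
    have "take (k + k) (rev ?p) = ?x @ ?x"
      using eq by (metis take_add)
    then have "drop (length ?p - (k + k)) ?p = rev ?x @ rev ?x"
      by (metis rev_append rev_rev_ident take_rev)
    moreover have "rev ?x \<noteq> []" using that by auto
    ultimately show False
      using drop assms(1) unfolding squarefree_word_def is_square_def by metis
  qed
  ultimately show ?thesis
    unfolding admissible_def by (auto simp: list_all_iff)
qed

text \<open>The word itself guides the search: after the prefix of length \<open>i\<close>, the
  letter \<open>w i\<close> is always a valid choice.\<close>

lemma extendable_prefix:
  assumes "range w \<subseteq> set A" and "squarefree_word w" and "\<not> factor u w"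
  shows "extendable A u n (rev (prefix i w))"
proof (induction n arbitrary: i)
  case 0
  show ?case by simp
next
  case (Suc n)
  have "rev (prefix (Suc i) w) = w i # rev (prefix i w)" by simp
  with Suc[of "Suc i"] have "list_ex (\<lambda>x. extendable A u n (x # rev (prefix i w))) A"
    using assms(1) unfolding list_ex_iff by (metis range_subsetD)
  with admissible_prefix[OF assms(2,3)] show ?case by simp
qed

text \<open>Depth 31 tests the lengths from 0 to 30; depth 30 does not suffice.\<close>

lemma not_extendable:
  "list_all (\<lambda>u. \<not> extendable [0, 1, 2] u 31 [])
    [[0,1,2], [0,2,1], [1,0,2], [1,2,0], [2,0,1], [2,1,0 :: nat]]"
  by code_simp

theorem theorem1:
  fixes w :: "nat word"
  assumes "range w \<subseteq> {0, 1, 2}"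
    and "squarefree_word w"
  shows "\<forall>u \<in> {[0,1,2], [0,2,1], [1,0,2], [1,2,0], [2,0,1], [2,1,0]}. factor u w"
proof (rule ccontr)
  assume "\<not> ?thesis"
  then obtain u where u: "u \<in> {[0,1,2], [0,2,1], [1,0,2], [1,2,0], [2,0,1], [2,1,0]}"
    and "\<not> factor u w" by blast
  \<comment> \<open>The prefix of length 0 is the empty word, the root of the search.\<close>
  with assms have "extendable [0, 1, 2] u 31 (rev (prefix 0 w))"
    by (intro extendable_prefix) auto
  with u not_extendable show False by auto
qed

end
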